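(* Let $(r_0,r_1)\in\mathbb{R}^2$. - If $-2<r_0\le -1$ and $-1<r_1\le 0$, then $(0,-1)$ is a cycle of $\tau_{(r_0,r_1)}$. - If $-1\le r_0<0$ and $0\le r_1<1$, then $(0,1)$ is a cycle of $\tau_{(r_0,r_1)}$. Thus, none of these parameters $(r_0,r_1)$ are in $\mathcal{D}_2^{( * )}$.
   Context: For $\mathbf{r}=(r_0,r_1)\in\mathbb{R}^2$, the two-dimensional shift radix system is the map $\tau_{\mathbf{r}}:\mathbb{Z}^2\to\mathbb{Z}^2$, $\tau_{\mathbf{r}}(a_0,a_1)=(a_1,-\lfloor r_0a_0+r_1a_1\rfloor)$. The orbit of $(a_0,a_1)$ is identified with the integer sequence $(a_n)_{n\ge 0}$ where $a_{n+2}=-\lfloor r_0a_n+r_1a_{n+1}\rfloor$ for $n\ge0$. An orbit is ultimately periodic if there are $n_0\ge 0$, $p>0$ with $a_{n+p}=a_n$ for all $n\ge n_0$; in this case $(a_n,\ldots,a_{n+p-1})$ with $n\ge n_0$ is called a cycle of $\tau_{\mathbf{r}}$. $\mathcal{D}_2^{( * )}$ is the set of all $\mathbf{r}\in\mathbb{R}^2$ such that each ultimately periodic orbit of $\tau_{\mathbf{r}}$ ends up in the trivial cycle $(0)$, i.e. satisfies $a_n=0$ for all sufficiently large $n$. *)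

theory Defs
  imports Complex_Main
begin

definition srs :: "real \<times> real \<Rightarrow> int \<times> int \<Rightarrow> int \<times> int" where
  "srs r a = (snd a, - \<lfloor>fst r * real_of_int (fst a) + snd r * real_of_int (snd a)\<rfloor>)"

text \<open>The orbit of \<open>a\<close> as an integer sequence: its first two terms are the components of \<open>a\<close>, and
  the \<open>n\<close>-th iterate of \<open>a\<close> is the pair of its terms number \<open>n\<close> and \<open>n + 1\<close>.\<close>

definition srs_orbit :: "real \<times> real \<Rightarrow> int \<times> int \<Rightarrow> nat \<Rightarrow> int" where
  "srs_orbit r a n = fst ((srs r ^^ n) a)"

lemma funpow_srs: "(srs r ^^ n) a = (srs_orbit r a n, srs_orbit r a (Suc n))"
  by (simp add: srs_orbit_def srs_def prod_eq_iff)

lemma srs_orbit_0: "srs_orbit r (x, y) 0 = x"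
  by (simp add: srs_orbit_def)

lemma srs_orbit_1: "srs_orbit r (x, y) (Suc 0) = y"
  by (simp add: srs_orbit_def srs_def)

lemma srs_orbit_Suc_Suc:
  "srs_orbit r a (Suc (Suc n)) =
    - \<lfloor>fst r * real_of_int (srs_orbit r a n) + snd r * real_of_int (srs_orbit r a (Suc n))\<rfloor>"
  by (simp add: srs_orbit_def srs_def)

definition periodic_from :: "(nat \<Rightarrow> int) \<Rightarrow> nat \<Rightarrow> nat \<Rightarrow> bool" where
  "periodic_from s n0 p \<longleftrightarrow> p > 0 \<and> (\<forall>n\<ge>n0. s (n + p) = s n)"

definition ultimately_periodic :: "(nat \<Rightarrow> int) \<Rightarrow> bool" where
  "ultimately_periodic s \<longleftrightarrow> (\<exists>n0 p. periodic_from s n0 p)"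

text \<open>As for ultimate periodicity, \<open>p\<close> is any period, not necessarily the least one.\<close>

definition srs_cycle :: "real \<times> real \<Rightarrow> int list \<Rightarrow> bool" where
  "srs_cycle r c \<longleftrightarrow>
    (\<exists>a n0 p n. periodic_from (srs_orbit r a) n0 p \<and> n \<ge> n0 \<and>
      c = map (srs_orbit r a) [n..<n + p])"

definition D2_star :: "(real \<times> real) set" where
  "D2_star = {r. \<forall>a. ultimately_periodic (srs_orbit r a) \<longrightarrow>
    (\<exists>N. \<forall>n\<ge>N. srs_orbit r a n = 0)}"

end

theory Submission
  imports Defs
begin

text \<open>In each parameter range the map \<open>srs\<close> exchanges two points,
  \<open>(0, -1)\<close> and \<open>(-1, 0)\<close> in the first, \<open>(0, 1)\<close> and
  \<open>(1, 0)\<close> in the second. The orbit of such a point alternates between its two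
  coordinates: this is a cycle of length 2 (\<open>srs_cycle_of_swap\<close>), and since one
  coordinate is nonzero, the orbit never settles at 0 (\<open>notin_D2_star_of_swap\<close>). Only
  two floors per range have to be computed.\<close>

lemma periodic_orbit_of_swap:
  assumes "srs r (x, y) = (y, x)" and "srs r (y, x) = (x, y)"
  shows "periodic_from (srs_orbit r (x, y)) 0 2"
proof -
  have "(srs r ^^ 2) (x, y) = (x, y)"
    using assms by (simp add: numeral_2_eq_2)
  then show ?thesis
    \<comment> \<open>With the deleted rule, \<open>n + 2\<close> would become
      \<open>Suc (Suc n)\<close>, hiding the sum that \<open>funpow_add\<close> splits.\<close>
    by (simp add: periodic_from_def srs_orbit_def funpow_add del: add_2_eq_Suc')
qed

lemma srs_cycle_of_swap:
  assumes "srs r (x, y) = (y, x)" and "srs r (y, x) = (x, y)"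
  shows "srs_cycle r [x, y]"
proof -
  have "[x, y] = map (srs_orbit r (x, y)) [0..<0 + 2]"
    by (simp add: upt_rec srs_orbit_0 srs_orbit_1)
  then show ?thesis
    unfolding srs_cycle_def using periodic_orbit_of_swap[OF assms] le_refl by metis
qed

text \<open>The orbit is periodic, yet \<open>y\<close> recurs at every odd index, so it is not
  eventually zero.\<close>

lemma notin_D2_star_of_swap:
  assumes "srs r (x, y) = (y, x)" and "srs r (y, x) = (x, y)" and "y \<noteq> 0"
  shows "r \<notin> D2_star"
proof
  let ?s = "srs_orbit r (x, y)"
  assume "r \<in> D2_star"
  moreover have per: "periodic_from ?s 0 2"
    using assms(1,2) by (rule periodic_orbit_of_swap)
  ultimately obtain N where N: "\<And>n. n \<ge> N \<Longrightarrow> ?s n = 0"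
    unfolding D2_star_def ultimately_periodic_def by blast
  have "?s (Suc (2 * n)) = y" for n
    using per by (induction n) (auto simp: periodic_from_def srs_orbit_1)
  with N[of "Suc (2 * N)"] \<open>y \<noteq> 0\<close> show False by simp
qed

theorem lemma4:
  fixes r0 r1 :: real
  shows "(-2 < r0 \<and> r0 \<le> -1 \<and> -1 < r1 \<and> r1 \<le> 0 \<longrightarrow> srs_cycle (r0, r1) [0, -1]) \<and>
    (-1 \<le> r0 \<and> r0 < 0 \<and> 0 \<le> r1 \<and> r1 < 1 \<longrightarrow> srs_cycle (r0, r1) [0, 1]) \<and>
    ((-2 < r0 \<and> r0 \<le> -1 \<and> -1 < r1 \<and> r1 \<le> 0) \<or> (-1 \<le> r0 \<and> r0 < 0 \<and> 0 \<le> r1 \<and> r1 < 1)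
      \<longrightarrow> (r0, r1) \<notin> D2_star)"
proof -
  have neg: "srs (r0, r1) (0, -1) = (-1, 0)" "srs (r0, r1) (-1, 0) = (0, -1)"
    if "-2 < r0 \<and> r0 \<le> -1 \<and> -1 < r1 \<and> r1 \<le> 0"
  proof -
    \<comment> \<open>The half-open ranges say exactly that \<open>- r1\<close> lies in [0, 1) and
      \<open>- r0\<close> in [1, 2).\<close>
    from that have "\<lfloor>- r1\<rfloor> = 0" "\<lfloor>- r0\<rfloor> = 1" by linarith+
    then show "srs (r0, r1) (0, -1) = (-1, 0)" "srs (r0, r1) (-1, 0) = (0, -1)"
      by (simp_all add: srs_def)
  qed
  have pos: "srs (r0, r1) (0, 1) = (1, 0)" "srs (r0, r1) (1, 0) = (0, 1)"
    if "-1 \<le> r0 \<and> r0 < 0 \<and> 0 \<le> r1 \<and> r1 < 1"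
  proof -
    \<comment> \<open>Here \<open>r1\<close> lies in [0, 1) and \<open>r0\<close> in [-1,
      0).\<close>
    from that have "\<lfloor>r1\<rfloor> = 0" "\<lfloor>r0\<rfloor> = -1" by linarith+
    then show "srs (r0, r1) (0, 1) = (1, 0)" "srs (r0, r1) (1, 0) = (0, 1)"
      by (simp_all add: srs_def)
  qed
  show ?thesis
    using srs_cycle_of_swap[OF neg] srs_cycle_of_swap[OF pos]
      notin_D2_star_of_swap[OF neg] notin_D2_star_of_swap[OF pos] by simp
qed

end
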